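(* Suppose $a\ge b>0$. Let $$F_1(\mu;x)=\frac{\partial}{\partial a}\,{}_3F_2\left(\begin{matrix}a,\ \mu/2,\ \mu/2+1/2\\ b,\ \mu+1\end{matrix};x\right),\qquad F_2(\mu;x)=-\frac{\partial}{\partial b}\,{}_3F_2\left(\begin{matrix}a,\ \mu/2,\ \mu/2+1/2\\ b,\ \mu+1\end{matrix};x\right).$$ Then for $i=1,2$ the Turán type inequality $$F_i(\mu+\alpha;x)F_i(\mu+\beta;x)-F_i(\mu;x)F_i(\mu+\alpha+\beta;x)\ge0$$ holds for each $\mu>0$, $0<x<1$ and $\alpha,\beta\in\mathbb{N}$. Moreover, for $i=1,2$ the coefficients at all powers of $x$ in the power series expansion of $F_i(\mu+\alpha;x)F_i(\mu+\beta;x)-F_i(\mu;x)F_i(\mu+\alpha+\beta;x)$ are non-negative if, furthermore, $\alpha+\beta\le4$.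
   Context: $\mathbb{N}=\{1,2,\dots\}$; $(\mu)_n$ is the rising factorial: $(\mu)_0=1$, $(\mu)_n=\mu(\mu+1)\cdots(\mu+n-1)$. ${}_3F_2\left(\begin{matrix}c_1,c_2,c_3\\ d_1,d_2\end{matrix};x\right)=\sum_{n\ge0}\frac{(c_1)_n(c_2)_n(c_3)_n}{(d_1)_n(d_2)_n\,n!}x^n$; the parameter derivatives are taken term by term, giving power series in $x$ that converge for $|x|<1$. *)

theory Defs
  imports "HOL-Analysis.Analysis"
begin

definition hyp_3F2 :: "real \<Rightarrow> real \<Rightarrow> real \<Rightarrow> real \<Rightarrow> real \<Rightarrow> real fps" where
  "hyp_3F2 c1 c2 c3 d1 d2 = fps_hypergeo [c1, c2, c3] [d1, d2] 1"

lemma hyp_3F2_nth: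
  "fps_nth (hyp_3F2 c1 c2 c3 d1 d2) n =
     pochhammer c1 n * pochhammer c2 n * pochhammer c3 n /
       (pochhammer d1 n * pochhammer d2 n * fact n)"
  by (simp add: hyp_3F2_def)

(* The parameter derivatives are taken term by term, so they are power series in x
   whose coefficients are the derivatives of the coefficients. *)

definition F1_fps :: "real \<Rightarrow> real \<Rightarrow> real \<Rightarrow> real fps" where
  "F1_fps a b \<mu> =
     Abs_fps (\<lambda>n. deriv (\<lambda>t. fps_nth (hyp_3F2 t (\<mu> / 2) (\<mu> / 2 + 1 / 2) b (\<mu> + 1)) n) a)"

definition F2_fps :: "real \<Rightarrow> real \<Rightarrow> real \<Rightarrow> real fps" where
  "F2_fps a b \<mu> =
     - Abs_fps (\<lambda>n. deriv (\<lambda>t. fps_nth (hyp_3F2 a (\<mu> / 2) (\<mu> / 2 + 1 / 2) t (\<mu> + 1)) n) b)"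

definition F1 :: "real \<Rightarrow> real \<Rightarrow> real \<Rightarrow> real \<Rightarrow> real" where
  "F1 a b \<mu> x = eval_fps (F1_fps a b \<mu>) x"

definition F2 :: "real \<Rightarrow> real \<Rightarrow> real \<Rightarrow> real \<Rightarrow> real" where
  "F2 a b \<mu> x = eval_fps (F2_fps a b \<mu>) x"

lemma has_field_derivative_pochhammer:
  fixes a :: real
  assumes "a > 0"
  shows "((\<lambda>t. pochhammer t n) has_field_derivative
           pochhammer a n * (\<Sum>k<n. 1 / (a + real k))) (at a)"
proof (induction n)
  case (Suc n)
  have "a + real n \<noteq> 0" using assms by (simp add: add_pos_nonneg less_imp_neq[symmetric])
  then show ?case
    unfolding pochhammer_Suc
    by (auto intro!: derivative_eq_intros Suc.IH simp: field_simps)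
qed auto

lemma F1_fps_nth:
  assumes "a > 0" "b > 0" "\<mu> > 0"
  shows "fps_nth (F1_fps a b \<mu>) n =
    fps_nth (hyp_3F2 a (\<mu> / 2) (\<mu> / 2 + 1 / 2) b (\<mu> + 1)) n * (\<Sum>k<n. 1 / (a + real k))"
proof -
  have "pochhammer b n > 0" "pochhammer (\<mu> + 1) n > 0"
    using assms by (auto intro!: pochhammer_pos)
  then show ?thesis
    unfolding F1_fps_def hyp_3F2_nth fps_nth_Abs_fps using assms
    by (intro DERIV_imp_deriv)
      (auto intro!: derivative_eq_intros has_field_derivative_pochhammer simp: field_simps)
qed

lemma F2_fps_nth:
  assumes "a > 0" "b > 0" "\<mu> > 0"
  shows "fps_nth (F2_fps a b \<mu>) n =
    fps_nth (hyp_3F2 a (\<mu> / 2) (\<mu> / 2 + 1 / 2) b (\<mu> + 1)) n * (\<Sum>k<n. 1 / (b + real k))"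
proof -
  have "pochhammer b n > 0" "pochhammer (\<mu> + 1) n > 0"
    using assms by (auto intro!: pochhammer_pos)
  then have "deriv (\<lambda>t. fps_nth (hyp_3F2 a (\<mu> / 2) (\<mu> / 2 + 1 / 2) t (\<mu> + 1)) n) b =
    - (fps_nth (hyp_3F2 a (\<mu> / 2) (\<mu> / 2 + 1 / 2) b (\<mu> + 1)) n * (\<Sum>k<n. 1 / (b + real k)))"
    unfolding hyp_3F2_nth using assms
    by (intro DERIV_imp_deriv)
      (auto intro!: derivative_eq_intros has_field_derivative_pochhammer
        simp: field_simps power2_eq_square)
  then show ?thesis by (simp add: F2_fps_def)
qed

lemma hyp_3F2_pos:
  assumes "c1 > 0" "c2 > 0" "c3 > 0" "d1 > 0" "d2 > 0"
  shows "fps_nth (hyp_3F2 c1 c2 c3 d1 d2) n > 0"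
  unfolding hyp_3F2_nth using assms by (auto intro!: divide_pos_pos mult_pos_pos pochhammer_pos)

lemma conv_radius_hyp_3F2:
  assumes "c1 > 0" "c2 > 0" "c3 > 0" "d1 > 0" "d2 > 0"
  shows "fps_conv_radius (hyp_3F2 c1 c2 c3 d1 d2) = 1"
  unfolding fps_conv_radius_def
proof (rule conv_radius_ratio_limit_nonzero)
  let ?h = "fps_nth (hyp_3F2 c1 c2 c3 d1 d2)"
  have r: "norm (?h n) / norm (?h (Suc n)) =
      ((d1 + n) * (d2 + n) * (1 + n)) / ((c1 + n) * (c2 + n) * (c3 + n))" for n
  proof -
    have p: "pochhammer c1 n > 0" "pochhammer c2 n > 0" "pochhammer c3 n > 0"
      "pochhammer d1 n > 0" "pochhammer d2 n > 0"
      using assms by (auto intro!: pochhammer_pos)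
    have q: "c1 + n > 0" "c2 + n > 0" "c3 + n > 0" "d1 + n > 0" "d2 + n > 0" using assms by auto
    have "norm (?h n) / norm (?h (Suc n)) = ?h n / ?h (Suc n)"
      using hyp_3F2_pos[OF assms, of n] hyp_3F2_pos[OF assms, of "Suc n"] by simp
    also have "\<dots> = ((d1 + n) * (d2 + n) * (1 + n)) / ((c1 + n) * (c2 + n) * (c3 + n))"
      using p q by (simp add: hyp_3F2_nth pochhammer_Suc divide_simps)
    finally show ?thesis .
  qed
  have l: "(\<lambda>n. (u + real n) / (v + real n)) \<longlonglongrightarrow> 1" if "v > 0" for u v :: real
  proof -
    have "(\<lambda>n. 1 + (u - v) * inverse (v + real n)) \<longlonglongrightarrow> 1 + (u - v) * 0"
      by (intro tendsto_intros tendsto_inverse_0_at_top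
          filterlim_tendsto_add_at_top[OF tendsto_const] filterlim_real_sequentially)
    moreover have "1 + (u - v) * inverse (v + real n) = (u + real n) / (v + real n)" for n
      using that by (simp add: field_simps add_pos_nonneg less_imp_neq[symmetric])
    ultimately show ?thesis by simp
  qed
  have "(\<lambda>n. (d1 + real n) / (c1 + real n) * ((d2 + real n) / (c2 + real n)) *
      ((1 + real n) / (c3 + real n))) \<longlonglongrightarrow> 1 * 1 * 1"
    by (intro tendsto_mult l assms)
  then show "(\<lambda>n. norm (?h n) / norm (?h (Suc n))) \<longlonglongrightarrow> 1"
    unfolding r by (simp add: mult_ac)
qed (auto simp: one_ereal_def)

lemma conv_radius_le_of_norm_le:
  fixes f g :: "nat \<Rightarrow> real"
  assumes "\<And>n. norm (g n) \<le> norm (f n)"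
  shows "conv_radius f \<le> conv_radius g"
proof (rule conv_radius_geI_ex')
  fix r :: real
  assume r: "0 < r" "ereal r < conv_radius f"
  have "summable (\<lambda>n. norm (f n * r ^ n))"
    using r by (intro abs_summable_in_conv_radius) auto
  then show "summable (\<lambda>n. g n * of_real r ^ n)"
    by (rule summable_comparison_test') (use assms r in \<open>auto simp: abs_mult intro!: mult_right_mono\<close>)
qed

lemma conv_radius_harmonic_mult:
  fixes f :: "real fps"
  assumes "c > 0" "fps_conv_radius f \<ge> 1" "\<And>n. fps_nth g n = fps_nth f n * (\<Sum>k<n. 1 / (c + real k))"
  shows "fps_conv_radius g \<ge> 1"
proof -
  have "1 \<le> fps_conv_radius (fps_X * fps_deriv f)"
    using assms(2) fps_conv_radius_deriv[of f] fps_conv_radius_mult[of fps_X "fps_deriv f"]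
    by (auto simp: min_def split: if_splits intro: order_trans)
  also have "\<dots> = fps_conv_radius (fps_const (1 / c) * (fps_X * fps_deriv f))"
    using assms(1) by (simp add: fps_conv_radius_cmult_left)
  also have "\<dots> \<le> fps_conv_radius g"
    unfolding fps_conv_radius_def
  proof (rule conv_radius_le_of_norm_le)
    fix n
    have "(\<Sum>k<n. 1 / (c + real k)) \<le> (\<Sum>k<n. 1 / c)"
      using assms(1) by (intro sum_mono) (auto intro!: divide_left_mono)
    then have s: "\<bar>\<Sum>k<n. 1 / (c + real k)\<bar> \<le> real n / c"
      using assms(1) by (simp add: abs_of_nonneg sum_nonneg)
    have "norm (fps_nth g n) \<le> \<bar>fps_nth f n\<bar> * (real n / c)"
      unfolding assms(3) real_norm_def abs_mult by (intro mult_left_mono s) simp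
    also have "\<dots> = norm (fps_nth (fps_const (1 / c) * (fps_X * fps_deriv f)) n)"
      using assms(1) by (cases n) (simp_all add: abs_mult mult_ac del: of_nat_Suc)
    finally show "norm (fps_nth g n) \<le> norm (fps_nth (fps_const (1 / c) * (fps_X * fps_deriv f)) n)" .
  qed
  finally show ?thesis .
qed

lemma conv_radius_F1:
  assumes "a > 0" "b > 0" "\<mu> > 0"
  shows "fps_conv_radius (F1_fps a b \<mu>) \<ge> 1"
  using assms by (intro conv_radius_harmonic_mult[OF _ _ F1_fps_nth]) (auto simp: conv_radius_hyp_3F2)

lemma conv_radius_F2:
  assumes "a > 0" "b > 0" "\<mu> > 0"
  shows "fps_conv_radius (F2_fps a b \<mu>) \<ge> 1"
  using assms by (intro conv_radius_harmonic_mult[OF _ _ F2_fps_nth]) (auto simp: conv_radius_hyp_3F2)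

end

(* Both F_i have the form sum f_n u_n(mu) x^n, where u_n(mu) are the Taylor coefficients of the mu-th
   power of the Catalan generating function C(x/4) and f_n is a log-concave sequence. The n-th
   coefficient of the Turanian is half the sum of f_k f_{n-k} w_k for a symmetrised kernel w_k; since
   the Turanian vanishes for f = 1, w_k sums to 0. Log-concavity makes f_k f_{n-k} increasing in q = k (n-k). For
   alpha = 1 and beta <= 3, w_k is a positive factor times a polynomial in q whose coefficients change
   sign once, from - to +, so w_k is positive where the weights are larger and the sum is
   nonnegative. The case (2,2) telescopes into (1,1) at mu + 1 plus (1,3) at mu. The inequality of
   functions for all alpha, beta needs only (1,1): it makes j |-> F_i(mu + j; x) log-concave. *)

theory Submission
  imports Defs
begin

section \<open>Log-concave sequences, zero-sum weights and polynomials with one sign change\<close>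

text \<open>The ratios f (n+1) / f n decrease, so moving two indices with fixed sum towards each
  other raises the product of the values; with fixed sum, a larger product of indices means a closer
  pair. The value \<open>f 0 = 0\<close> has to be allowed, since both F_i start with an empty
  harmonic sum.\<close>

lemma log_concave_nat_mult_le:
  fixes f :: "nat \<Rightarrow> real"
  assumes lc: "\<And>n. f n * f (Suc (Suc n)) \<le> f (Suc n) ^ 2"
    and f0: "f 0 \<ge> 0" and pos: "\<And>n. f (Suc n) > 0"
    and "i + j = k + m" "i * j \<le> k * m"
  shows "f i * f j \<le> f k * f m"
proof -
  have nn: "f n \<ge> 0" for n
    using f0 pos by (cases n) (auto intro: less_imp_le)
  have step: "f i * f (Suc j) \<le> f (Suc i) * f j" if "i \<le> j" for i j
    using that
  proof (induction rule: dec_induct)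
    case (step j)
    show ?case
    proof (cases "f j = 0")
      case True
      \<comment> \<open>Only \<open>f 0\<close> can vanish; then \<open>i = 0\<close> too and the
        left-hand side is 0.\<close>
      with pos have "j = 0" by (metis less_irrefl not0_implies_Suc)
      with step True show ?thesis using nn by (auto intro!: mult_nonneg_nonneg)
    next
      case False
      with nn have "f j > 0" by (metis less_eq_real_def)
      have "f j * (f i * f (Suc (Suc j))) = f i * (f j * f (Suc (Suc j)))" by simp
      also have "\<dots> \<le> f i * f (Suc j) ^ 2" by (intro mult_left_mono lc nn)
      also have "\<dots> = f (Suc j) * (f i * f (Suc j))" by (simp add: power2_eq_square)
      also have "\<dots> \<le> f (Suc j) * (f (Suc i) * f j)" by (intro mult_left_mono step nn)
      finally have "f j * (f i * f (Suc (Suc j))) \<le> f j * (f (Suc i) * f (Suc j))"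
        by (simp add: mult_ac)
      then show ?thesis using \<open>f j > 0\<close> by simp
    qed
  qed simp
  \<comment> \<open>Repeated use of \<open>step\<close>; once \<open>i\<close> reaches
    \<open>j\<close>, both sides are the same product.\<close>
  have shift: "f i * f (j + d) \<le> f (i + d) * f j" if "i \<le> j" for i j d
    using that
  proof (induction d arbitrary: i)
    case (Suc d)
    show ?case
    proof (cases "i = j")
      case False
      then have "f (Suc i) * f (j + d) \<le> f (Suc i + d) * f j"
        using Suc by (intro Suc.IH) auto
      moreover have "f i * f (Suc (j + d)) \<le> f (Suc i) * f (j + d)"
        using Suc by (intro step) auto
      ultimately show ?thesis by simp
    qed simp
  qed simp
  have main: "f i * f j \<le> f k * f m"
    if "i + j = k + m" "i * j \<le> k * m" "i \<le> j" "k \<le> m" for i j k m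
  proof -
    \<comment> \<open>If \<open>i > k\<close>, then (k, m) would be the wider pair and have the
      strictly smaller product.\<close>
    have "i \<le> k"
    proof (rule ccontr)
      assume "\<not> i \<le> k"
      then obtain e where e: "i = k + e" "e > 0" by (metis less_imp_add_positive not_le)
      with that have m: "m = j + e" by simp
      have "k * e < j * e" using e that by simp
      then show False using that(2) unfolding e(1) m by (simp add: algebra_simps)
    qed
    then obtain d where d: "k = i + d" by (metis le_iff_add)
    with that have "j = m + d" by simp
    with d shift[of i m d] that show ?thesis by simp
  qed
  show ?thesis
    using main[of i j k m] main[of j i k m] main[of i j m k] main[of j i m k] assms(4,5)
    by (cases "i \<le> j"; cases "k \<le> m") (simp_all add: mult.commute add.commute)
qed

text \<open>Since \<open>w\<close> has sum 0, \<open>g\<close> may be replaced by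
  \<open>g - c\<close>. With \<open>c\<close> the least value of \<open>g\<close> where
  \<open>w\<close> is positive, every term becomes nonnegative.\<close>

lemma sum_weighted_nonneg:
  fixes g w :: "'a \<Rightarrow> real"
  assumes "finite A" "(\<Sum>k\<in>A. w k) = 0"
    and mono: "\<And>i j. i \<in> A \<Longrightarrow> j \<in> A \<Longrightarrow> w i > 0 \<Longrightarrow> w j < 0 \<Longrightarrow> g j \<le> g i"
  shows "(\<Sum>k\<in>A. g k * w k) \<ge> 0"
proof (cases "\<exists>i\<in>A. w i > 0")
  case True
  define c where "c = Min (g ` {i\<in>A. w i > 0})"
  have fin: "finite (g ` {i\<in>A. w i > 0})" "g ` {i\<in>A. w i > 0} \<noteq> {}"
    using assms(1) True by auto
  from Min_in[OF fin] obtain i where i: "i \<in> A" "w i > 0" "c = g i" by (auto simp: c_def)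
  have "(g k - c) * w k \<ge> 0" if "k \<in> A" for k
  proof (cases "w k > 0")
    case True
    then have "c \<le> g k" unfolding c_def using fin that by (intro Min_le) auto
    with True show ?thesis by simp
  next
    case False
    then show ?thesis using mono[of i k] i that
      by (cases "w k = 0") (auto intro!: mult_nonpos_nonpos)
  qed
  then have "0 \<le> (\<Sum>k\<in>A. (g k - c) * w k)" by (intro sum_nonneg)
  also have "\<dots> = (\<Sum>k\<in>A. g k * w k) - c * (\<Sum>k\<in>A. w k)"
    by (simp add: left_diff_distrib sum_subtractf sum_distrib_left)
  finally show ?thesis using assms(2) by simp
next
  case False
  \<comment> \<open>Without a positive value, the zero sum forces \<open>w\<close> to vanish on
    \<open>A\<close>.\<close>
  then have "\<forall>k\<in>A. - w k \<ge> 0" by (auto simp: not_less)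
  moreover have "(\<Sum>k\<in>A. - w k) = 0" using assms(2) by (simp add: sum_negf)
  ultimately have "\<forall>k\<in>A. - w k = 0" using assms(1) by (subst (asm) sum_nonneg_eq_0_iff) auto
  then show ?thesis by simp
qed

text \<open>Dividing by q^2 if \<open>c1 \<le> 0\<close>, or by q if \<open>c2 \<ge> 0\<close>,
  leaves a nondecreasing function of q > 0: the lower coefficients are nonpositive, the higher ones
  nonnegative. With \<open>y = t * x\<close> this monotonicity bounds the value at \<open>y\<close>
  below by t^2 or t times the value at \<open>x\<close>.\<close>

lemma quartic_pos_mono:
  fixes x y :: real
  defines "P \<equiv> \<lambda>q c0 c1 c2 c3 c4. c0 + c1 * q + c2 * q^2 + c3 * q^3 + c4 * q^4"
  assumes c: "c0 \<le> 0" "c1 \<le> 0 \<or> c2 \<ge> 0" "c3 \<ge> 0" "c4 \<ge> 0"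
    and xy: "0 \<le> x" "x \<le> y" and pos: "P x c0 c1 c2 c3 c4 > 0"
  shows "P y c0 c1 c2 c3 c4 > 0"
proof -
  have "x > 0" using pos c(1) xy(1) by (cases "x = 0") (auto simp: P_def)
  define t where "t = y / x"
  have t: "t \<ge> 1" and y: "y = t * x" using xy \<open>x > 0\<close> by (auto simp: t_def)
  have tt: "t \<le> t^2" "t^2 \<le> t^3" "t^2 \<le> t^4" "t \<le> t^3" "t \<le> t^4" "1 \<le> t^2"
    using t power_increasing[of 1 2 t] power_increasing[of 2 3 t] power_increasing[of 2 4 t]
      power_increasing[of 1 3 t] power_increasing[of 1 4 t] by auto
  have "\<exists>s>0. P y c0 c1 c2 c3 c4 \<ge> s * P x c0 c1 c2 c3 c4"
    using c(2)
  proof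
    assume "c1 \<le> 0"
    have "c0 * t^2 \<le> c0" "(c1 * x) * t^2 \<le> (c1 * x) * t"
      "(c3 * x^3) * t^2 \<le> (c3 * x^3) * t^3" "(c4 * x^4) * t^2 \<le> (c4 * x^4) * t^4"
      using mult_left_mono_neg[OF tt(6) c(1)] mult_left_mono_neg[OF tt(1), of "c1 * x"]
        mult_left_mono[OF tt(2), of "c3 * x^3"] mult_left_mono[OF tt(3), of "c4 * x^4"]
        mult_nonpos_nonneg[OF \<open>c1 \<le> 0\<close>, of x] c \<open>x > 0\<close> by simp_all
    then have "P y c0 c1 c2 c3 c4 \<ge> t^2 * P x c0 c1 c2 c3 c4"
      by (simp add: P_def y power_mult_distrib algebra_simps)
    then show ?thesis using t by (intro exI[of _ "t^2"]) auto
  next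
    assume "c2 \<ge> 0"
    have "c0 * t \<le> c0" "(c2 * x^2) * t \<le> (c2 * x^2) * t^2"
      "(c3 * x^3) * t \<le> (c3 * x^3) * t^3" "(c4 * x^4) * t \<le> (c4 * x^4) * t^4"
      using mult_left_mono_neg[OF t c(1)] mult_left_mono[OF tt(1), of "c2 * x^2"]
        mult_left_mono[OF tt(4), of "c3 * x^3"] mult_left_mono[OF tt(5), of "c4 * x^4"]
        \<open>c2 \<ge> 0\<close> c \<open>x > 0\<close> by simp_all
    then have "P y c0 c1 c2 c3 c4 \<ge> t * P x c0 c1 c2 c3 c4"
      by (simp add: P_def y power_mult_distrib algebra_simps)
    then show ?thesis using t by (intro exI[of _ t]) auto
  qed
  then show ?thesis using pos by (meson less_le_trans mult_pos_pos)
qed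

section \<open>Coefficients of powers of the Catalan generating function\<close>

text \<open>Coefficients of \<open>C(x/4)\<^sup>\<mu>\<close> with \<open>C(x) = (1 - sqrt (1 - 4x)) / (2x)\<close>; the
  functional equation \<open>C = 1 + x C\<^sup>2\<close> is what \<open>catalan_coeff_rec\<close> below expresses.\<close>

definition catalan_coeff :: "real \<Rightarrow> nat \<Rightarrow> real" where
  "catalan_coeff \<mu> n =
     pochhammer (\<mu> / 2) n * pochhammer (\<mu> / 2 + 1 / 2) n / (pochhammer (\<mu> + 1) n * fact n)"

lemma catalan_coeff_0 [simp]: "catalan_coeff \<mu> 0 = 1"
  by (simp add: catalan_coeff_def)

lemma catalan_coeff_pos: "\<mu> > 0 \<Longrightarrow> catalan_coeff \<mu> n > 0"
  unfolding catalan_coeff_def by (auto intro!: divide_pos_pos mult_pos_pos pochhammer_pos)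

lemma pochhammer_shift: "z * pochhammer (z + 1) n = pochhammer z n * (z + of_nat n)"
  for z :: "'a :: comm_semiring_1"
  by (metis pochhammer_Suc pochhammer_rec)

text \<open>Raising \<open>\<mu>\<close> by one turns the numerator parameters
  \<open>\<mu> / 2\<close> and \<open>\<mu> / 2 + 1 / 2\<close> into
  \<open>\<mu> / 2 + 1 / 2\<close> and \<open>\<mu> / 2 + 1\<close>: one is kept and the other moves
  by an integer, so the quotient of the coefficients is rational in \<open>\<mu>\<close> and
  \<open>n\<close>.\<close>

lemma catalan_coeff_plus1:
  assumes "\<mu> > 0"
  shows "catalan_coeff (\<mu> + 1) n * (\<mu> * (\<mu> + n + 1)) = catalan_coeff \<mu> n * (\<mu> + 1) * (\<mu> + 2 * n)"
proof -
  define A B where "A = pochhammer (\<mu> / 2) n" and "B = pochhammer (\<mu> / 2 + 1 / 2) n"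
  define C where "C = pochhammer (\<mu> + 1) n"
  have "C > 0" using assms by (auto simp: C_def intro!: pochhammer_pos)
  have a: "pochhammer (\<mu> / 2 + 1) n = A * (\<mu> + 2 * n) / \<mu>"
    using pochhammer_shift[of "\<mu> / 2" n] assms by (simp add: A_def field_simps)
  have c: "pochhammer (\<mu> + 1 + 1) n = C * (\<mu> + n + 1) / (\<mu> + 1)"
    using pochhammer_shift[of "\<mu> + 1" n] assms by (simp add: C_def field_simps)
  have h: "(\<mu> + 1) / 2 = \<mu> / 2 + 1 / 2" "\<mu> / 2 + 1 / 2 + 1 / 2 = \<mu> / 2 + 1" by (simp_all add: field_simps)
  have "\<mu> + n + 1 > 0" using assms by simp
  have "catalan_coeff (\<mu> + 1) n =
      B * (A * (\<mu> + 2 * n) / \<mu>) / (C * (\<mu> + n + 1) / (\<mu> + 1) * fact n)"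
    by (simp only: catalan_coeff_def h a c B_def)
  also have "\<dots> * (\<mu> * (\<mu> + n + 1)) = (A * B / (C * fact n)) * (\<mu> + 1) * (\<mu> + 2 * n)"
    using \<open>C > 0\<close> \<open>\<mu> + n + 1 > 0\<close> assms by (simp add: divide_simps)
  finally show ?thesis by (simp add: catalan_coeff_def A_def B_def C_def)
qed

text \<open>Iterates \<open>catalan_coeff_plus1\<close>; the factors (mu + i + 1) / (mu + i)
  telescope.\<close>

lemma catalan_coeff_shift:
  assumes "\<mu> > 0"
  shows "catalan_coeff (\<mu> + real j) n * (\<mu> * pochhammer (\<mu> + n + 1) j) =
    catalan_coeff \<mu> n * (\<mu> + j) * pochhammer (\<mu> + 2 * n) j"
proof (induction j)
  case (Suc j)
  define c d where "c = catalan_coeff (\<mu> + real j) n" and "d = catalan_coeff (\<mu> + real j + 1) n"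
  have eq: "d * ((\<mu> + j) * (\<mu> + j + n + 1)) = c * (\<mu> + j + 1) * (\<mu> + j + 2 * n)"
    using catalan_coeff_plus1[of "\<mu> + real j" n] assms by (simp add: c_def d_def)
  \<comment> \<open>The extra factor \<open>\<mu> + j\<close>, cancelled at the end, lets
    \<open>eq\<close> be applied without division.\<close>
  have "(\<mu> + j) * (d * (\<mu> * pochhammer (\<mu> + n + 1) (Suc j))) =
      (d * ((\<mu> + j) * (\<mu> + j + n + 1))) * (\<mu> * pochhammer (\<mu> + n + 1) j)"
    by (simp add: pochhammer_Suc algebra_simps)
  also have "\<dots> = (c * (\<mu> * pochhammer (\<mu> + n + 1) j)) * (\<mu> + j + 1) * (\<mu> + j + 2 * n)"
    unfolding eq by (simp only: mult_ac)
  also have "\<dots> = (\<mu> + j) * (catalan_coeff \<mu> n * (\<mu> + Suc j) * pochhammer (\<mu> + 2 * n) (Suc j))"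
    unfolding Suc.IH[folded c_def] by (simp add: pochhammer_Suc algebra_simps)
  finally show ?case using assms by (simp add: d_def add_ac)
qed auto

text \<open>Compares coefficients in C^(mu+1) = C^mu + (x/4) C^(mu+2), with C taken at x/4. All
  three values are rational multiples of \<open>catalan_coeff \<mu> n\<close>, so an algebraic
  identity remains.\<close>

lemma catalan_coeff_rec:
  assumes "\<mu> > 0"
  shows "catalan_coeff (\<mu> + 1) (Suc n) = catalan_coeff \<mu> (Suc n) + catalan_coeff (\<mu> + 2) n / 4"
proof -
  define c where "c = catalan_coeff \<mu> n"
  have p: "\<mu> + n + 1 > 0" "\<mu> + n + 2 > 0" "pochhammer (\<mu> + 1) n > 0"
    using assms by (auto intro!: pochhammer_pos)
  have 1: "catalan_coeff \<mu> (Suc n) = c * (\<mu> + 2 * n) * (\<mu> + 2 * n + 1) / (4 * (\<mu> + n + 1) * (n + 1))"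
    using p by (simp add: c_def catalan_coeff_def pochhammer_Suc divide_simps) (simp add: algebra_simps)
  have 2: "catalan_coeff (\<mu> + 1) (Suc n) =
      catalan_coeff \<mu> (Suc n) * (\<mu> + 1) * (\<mu> + 2 * n + 2) / (\<mu> * (\<mu> + n + 2))"
    using catalan_coeff_plus1[OF assms, of "Suc n"] assms p
    by (simp add: nonzero_eq_divide_eq add_ac)
  have 3: "catalan_coeff (\<mu> + 2) n =
      c * (\<mu> + 2) * (\<mu> + 2 * n) * (\<mu> + 2 * n + 1) / (\<mu> * (\<mu> + n + 1) * (\<mu> + n + 2))"
    using catalan_coeff_shift[OF assms, of 2 n] assms p
    by (simp add: pochhammer_Suc numeral_2_eq_2 c_def nonzero_eq_divide_eq mult_ac add_ac)
  have "real n + 1 > 0" by simp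
  show ?thesis
    unfolding 2 3 1 using assms p \<open>real n + 1 > 0\<close>
    by (simp add: divide_simps) algebra
qed

text \<open>Both sides are the n-th coefficient of C^(mu+nu+1); this is why the Turan kernel sums to
  zero. Induction with the recurrence replaces the use of real powers of a series.\<close>

lemma catalan_coeff_convolution:
  assumes "\<mu> > 0" "\<nu> > 0"
  shows "(\<Sum>k\<le>n. catalan_coeff (\<mu> + 1) k * catalan_coeff \<nu> (n - k)) =
    (\<Sum>k\<le>n. catalan_coeff \<mu> k * catalan_coeff (\<nu> + 1) (n - k))"
proof -
  define U where "U \<mu> = Abs_fps (catalan_coeff \<mu>)" for \<mu>
  have rec: "U (\<mu> + 1) = U \<mu> + fps_X * (fps_const (1 / 4) * U (\<mu> + 2))" if "\<mu> > 0" for \<mu>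
  proof (rule fps_ext)
    fix n
    show "fps_nth (U (\<mu> + 1)) n = fps_nth (U \<mu> + fps_X * (fps_const (1 / 4) * U (\<mu> + 2))) n"
      using catalan_coeff_rec[OF that] by (cases n) (simp_all add: U_def)
  qed
  have "fps_nth (U (\<mu> + 1) * U \<nu>) n = fps_nth (U \<mu> * U (\<nu> + 1)) n"
    using assms
  proof (induction n arbitrary: \<mu> \<nu>)
    case 0
    then show ?case by (simp add: U_def)
  next
    case (Suc n)
    \<comment> \<open>The shift by 2 passes from one factor to the other in two unit steps, each an
      instance of the induction hypothesis.\<close>
    have "fps_nth (U (\<mu> + 2) * U \<nu>) n = fps_nth (U (\<mu> + 1) * U (\<nu> + 1)) n"
      using Suc.IH[of "\<mu> + 1" \<nu>] Suc.prems by (simp add: add_ac)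
    also have "\<dots> = fps_nth (U \<mu> * U (\<nu> + 2)) n"
      using Suc.IH[of \<mu> "\<nu> + 1"] Suc.prems by (simp add: add_ac)
    finally have eq: "fps_nth (U (\<mu> + 2) * U \<nu>) n = fps_nth (U \<mu> * U (\<nu> + 2)) n" .
    \<comment> \<open>Expanding both shifted series cancels \<open>U \<mu> * U \<nu>\<close>; the
      factor X lowers the coefficient index to \<open>n\<close>.\<close>
    have "fps_nth (U (\<mu> + 1) * U \<nu> - U \<mu> * U (\<nu> + 1)) (Suc n) = fps_nth
        (fps_X * (fps_const (1 / 4) * (U (\<mu> + 2) * U \<nu> - U \<mu> * U (\<nu> + 2)))) (Suc n)"
      unfolding rec[OF Suc.prems(1)] rec[OF Suc.prems(2)] by (simp add: algebra_simps)
    also have "\<dots> = 0"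
      by (simp add: eq)
    finally show ?case by simp
  qed
  then show ?thesis by (simp add: U_def fps_mult_nth atLeast0AtMost)
qed

section \<open>The symmetrised kernel and its sign\<close>

text \<open>Collects what multiplies f_k f_m in the Turanian for the shifts 1 and
  \<open>\<beta>\<close>, from both orders of the indices.\<close>

definition turan_kernel :: "nat \<Rightarrow> real \<Rightarrow> nat \<Rightarrow> nat \<Rightarrow> real" where
  "turan_kernel \<beta> \<mu> k m =
     catalan_coeff (\<mu> + 1) k * catalan_coeff (\<mu> + real \<beta>) m
   + catalan_coeff (\<mu> + 1) m * catalan_coeff (\<mu> + real \<beta>) k
   - catalan_coeff \<mu> k * catalan_coeff (\<mu> + 1 + real \<beta>) m
   - catalan_coeff \<mu> m * catalan_coeff (\<mu> + 1 + real \<beta>) k"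

text \<open>The numerator of \<open>turan_kernel\<close> over its common denominator, with the
  values of \<open>catalan_coeff\<close> at \<open>\<mu>\<close> factored out.\<close>

definition turan_poly :: "nat \<Rightarrow> real \<Rightarrow> real \<Rightarrow> real \<Rightarrow> real" where
  "turan_poly \<beta> \<mu> k m =
     (\<mu> + 1) * (\<mu> + \<beta>) *
       ((\<mu> + 2 * k) * pochhammer (\<mu> + 2 * m) \<beta> * (pochhammer (\<mu> + k + 2) \<beta> * (\<mu> + m + 1 + \<beta>))
      + (\<mu> + 2 * m) * pochhammer (\<mu> + 2 * k) \<beta> * (pochhammer (\<mu> + m + 2) \<beta> * (\<mu> + k + 1 + \<beta>)))
   - \<mu> * (\<mu> + 1 + \<beta>) *
       (pochhammer (\<mu> + 2 * m) (Suc \<beta>) * pochhammer (\<mu> + k + 1) (Suc \<beta>)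
      + pochhammer (\<mu> + 2 * k) (Suc \<beta>) * pochhammer (\<mu> + m + 1) (Suc \<beta>))"

text \<open>The factors multiplying kernel and polynomial are positive, so the two have the same
  sign.\<close>

lemma turan_kernel_eq:
  assumes "\<mu> > 0"
  shows "turan_kernel \<beta> \<mu> k m *
      (\<mu>^2 * pochhammer (\<mu> + k + 1) (Suc \<beta>) * pochhammer (\<mu> + m + 1) (Suc \<beta>)) =
    catalan_coeff \<mu> k * catalan_coeff \<mu> m * turan_poly \<beta> \<mu> k m"
proof -
  let ?c = "catalan_coeff" and ?S = "\<lambda>k::nat. pochhammer (\<mu> + k + 1)"
  \<comment> \<open>Of the common denominator, the shift by 1 uses only the first factor, the shift
    by \<open>\<beta>\<close> all but the last.\<close>
  have S1: "?S k (Suc \<beta>) = (\<mu> + k + 1) * pochhammer (\<mu> + k + 2) \<beta>" for k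
    by (simp add: pochhammer_rec add_ac)
  have S2: "?S k (Suc \<beta>) = ?S k \<beta> * (\<mu> + k + 1 + \<beta>)" for k
    by (simp add: pochhammer_Suc add_ac)
  have s1: "?c (\<mu> + 1) k * (\<mu> * (\<mu> + k + 1)) = ?c \<mu> k * (\<mu> + 1) * (\<mu> + 2 * k)" for k
    by (rule catalan_coeff_plus1[OF assms])
  have sb: "?c (\<mu> + \<beta>) k * (\<mu> * ?S k \<beta>) = ?c \<mu> k * (\<mu> + \<beta>) * pochhammer (\<mu> + 2 * k) \<beta>" for k
    by (rule catalan_coeff_shift[OF assms])
  have sc: "?c (\<mu> + 1 + \<beta>) k * (\<mu> * ?S k (Suc \<beta>)) =
      ?c \<mu> k * (\<mu> + 1 + \<beta>) * pochhammer (\<mu> + 2 * k) (Suc \<beta>)" for k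
    using catalan_coeff_shift[OF assms, of "Suc \<beta>" k] by (simp add: add_ac)
  \<comment> \<open>\<open>p\<close> serves the two positive products and \<open>n\<close> the two
    negative ones; \<open>D\<close> allows exchanging \<open>k\<close> and \<open>m\<close>.\<close>
  have p: "?c (\<mu> + 1) k * ?c (\<mu> + \<beta>) m * (\<mu>^2 * ?S k (Suc \<beta>) * ?S m (Suc \<beta>)) =
      ?c \<mu> k * ?c \<mu> m * ((\<mu> + 1) * (\<mu> + \<beta>) *
        ((\<mu> + 2 * k) * pochhammer (\<mu> + 2 * m) \<beta> * (pochhammer (\<mu> + k + 2) \<beta> * (\<mu> + m + 1 + \<beta>))))"
    for k m
  proof -
    have "?c (\<mu> + 1) k * ?c (\<mu> + \<beta>) m * (\<mu>^2 * ?S k (Suc \<beta>) * ?S m (Suc \<beta>)) =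
        (?c (\<mu> + 1) k * (\<mu> * (\<mu> + k + 1))) * (?c (\<mu> + \<beta>) m * (\<mu> * ?S m \<beta>)) *
        (pochhammer (\<mu> + k + 2) \<beta> * (\<mu> + m + 1 + \<beta>))"
      unfolding S1[of k] S2[of m] power2_eq_square by (simp only: mult_ac)
    then show ?thesis unfolding s1 sb by (simp only: mult_ac)
  qed
  have n: "?c \<mu> k * ?c (\<mu> + 1 + \<beta>) m * (\<mu>^2 * ?S k (Suc \<beta>) * ?S m (Suc \<beta>)) =
      ?c \<mu> k * ?c \<mu> m * (\<mu> * (\<mu> + 1 + \<beta>) * (pochhammer (\<mu> + 2 * m) (Suc \<beta>) * ?S k (Suc \<beta>)))"
    for k m
  proof -
    have "?c \<mu> k * ?c (\<mu> + 1 + \<beta>) m * (\<mu>^2 * ?S k (Suc \<beta>) * ?S m (Suc \<beta>)) =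
        ?c \<mu> k * \<mu> * ?S k (Suc \<beta>) * (?c (\<mu> + 1 + \<beta>) m * (\<mu> * ?S m (Suc \<beta>)))"
      unfolding power2_eq_square by (simp only: mult_ac)
    then show ?thesis unfolding sc by (simp only: mult_ac)
  qed
  let ?D = "\<mu>^2 * ?S k (Suc \<beta>) * ?S m (Suc \<beta>)"
  have D: "?D = \<mu>^2 * ?S m (Suc \<beta>) * ?S k (Suc \<beta>)" by (simp only: mult_ac)
  have "turan_kernel \<beta> \<mu> k m * ?D =
      ?c (\<mu> + 1) k * ?c (\<mu> + \<beta>) m * ?D + ?c (\<mu> + 1) m * ?c (\<mu> + \<beta>) k * ?D
      - ?c \<mu> k * ?c (\<mu> + 1 + \<beta>) m * ?D - ?c \<mu> m * ?c (\<mu> + 1 + \<beta>) k * ?D"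
    unfolding turan_kernel_def by (simp only: distrib_right left_diff_distrib)
  also have "\<dots> = catalan_coeff \<mu> k * catalan_coeff \<mu> m * turan_poly \<beta> \<mu> k m"
    unfolding p n p[of m k, folded D] n[of m k, folded D] turan_poly_def
    by (simp add: algebra_simps)
  finally show ?thesis .
qed

lemma pochhammer_numerals:
  fixes z :: real
  shows "pochhammer z 1 = z" "pochhammer z (Suc 1) = z * (z + 1)"
    "pochhammer z 2 = z * (z + 1)" "pochhammer z (Suc 2) = z * (z + 1) * (z + 2)"
    "pochhammer z 3 = z * (z + 1) * (z + 2)"
    "pochhammer z (Suc 3) = z * (z + 1) * (z + 2) * (z + 3)"
  by (simp_all add: pochhammer_Suc numeral_eq_Suc)

text \<open>Being symmetric in \<open>k\<close> and \<open>m\<close>, the polynomial is one in \<open>k + m\<close> and \<open>q = k m\<close>; the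
  hypotheses on the coefficients of \<open>q\<close> allow a single sign change.\<close>

lemma turan_poly_expand:
  assumes "\<mu> > 0" "\<beta> \<in> {1, 2, 3}"
  obtains c0 c1 c2 c3 c4 :: real
  where "c0 \<le> 0" "c1 \<le> 0 \<or> c2 \<ge> 0" "c3 \<ge> 0" "c4 \<ge> 0"
    and "\<And>k m. k + m = N \<Longrightarrow> turan_poly \<beta> \<mu> (real k) (real m) =
      c0 + c1 * (real k * real m) + c2 * (real k * real m)^2 + c3 * (real k * real m)^3
        + c4 * (real k * real m)^4"
proof -
  define n where "n = real N"
  \<comment> \<open>The second bound uses that n is an integer; it gives the sign of
    \<open>c0\<close>.\<close>
  have n: "n \<ge> 0" "n * (n - 1) \<ge> 0" by (cases N; simp add: n_def)+
  have N: "n = real k + real m" if "k + m = N" for k m using that by (simp add: n_def flip: of_nat_add)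
  consider "\<beta> = 1" | "\<beta> = 2" | "\<beta> = 3" using assms(2) by auto
  then show ?thesis
  proof cases
    case 1
    \<comment> \<open>The value at q = 0. For N at most 1, q is always 0 and the kernel, symmetric
      with sum zero, vanishes; hence the factor n (n - 1).\<close>
    define c0 :: real where "c0 =
       - (n * (n - 1)) *
       ((1 * \<mu>^4 + 7 * \<mu>^3 + 14 * \<mu>^2 + 8 * \<mu>))"
    define c1 :: real where "c1 =
       (2 * \<mu>^2 + 16 * \<mu> + 16) * n + (4 * \<mu>^4 + 34 * \<mu>^3 + 98 * \<mu>^2 + 104 * \<mu>
        + 32)"
    define c2 :: real where "c2 = 8"
    define c3 :: real where "c3 = 0"
    define c4 :: real where "c4 = 0"
    show ?thesis
    proof (rule that[of c0 c1 c2 c3 c4])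
      show "c0 \<le> 0"
        unfolding c0_def using n assms(1) by (intro mult_nonpos_nonneg) auto
      show "c3 \<ge> 0" "c4 \<ge> 0"
        unfolding c3_def c4_def using n assms(1) by auto
      show "c1 \<le> 0 \<or> c2 \<ge> 0"
        unfolding c2_def using n assms(1) by auto
      fix k m assume "k + m = N"
      show "turan_poly \<beta> \<mu> (real k) (real m) =
          c0 + c1 * (real k * real m) + c2 * (real k * real m)^2 + c3 * (real k * real m)^3
            + c4 * (real k * real m)^4"
        unfolding c0_def c1_def c2_def c3_def c4_def N[OF \<open>k + m = N\<close>] turan_poly_def \<open>\<beta> = 1\<close>
          pochhammer_numerals of_nat_numeral of_nat_1
        by algebra
    qed
  next
    case 2
    define c0 :: real where "c0 =
       - (n * (n - 1)) *
       ((3 * \<mu>^5 + 32 * \<mu>^4 + 117 * \<mu>^3 + 172 * \<mu>^2 + 84 * \<mu>) * n + (2 * \<mu>^6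
        + 24 * \<mu>^5 + 106 * \<mu>^4 + 216 * \<mu>^3 + 204 * \<mu>^2 + 72 * \<mu>))"
    \<comment> \<open>This takes both signs as n and \<open>\<mu>\<close> vary, but
      \<open>c2\<close> has only positive coefficients.\<close>
    define c1 :: real where "c1 =
       (- 4 * \<mu>^4 - 30 * \<mu>^3 - 34 * \<mu>^2 + 84 * \<mu> + 120) * n^2 + (12 * \<mu>^5 + 154 * \<mu>^4
        + 738 * \<mu>^3 + 1568 * \<mu>^2 + 1440 * \<mu> + 456) * n + (8 * \<mu>^6 + 108 * \<mu>^5
        + 564 * \<mu>^4 + 1440 * \<mu>^3 + 1896 * \<mu>^2 + 1224 * \<mu> + 288)"
    define c2 :: real where "c2 =
       (8 * \<mu>^2 + 96 * \<mu> + 136) * n + (16 * \<mu>^4 + 168 * \<mu>^3 + 616 * \<mu>^2 + 840 * \<mu>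
        + 320)"
    define c3 :: real where "c3 = 32"
    define c4 :: real where "c4 = 0"
    show ?thesis
    proof (rule that[of c0 c1 c2 c3 c4])
      show "c0 \<le> 0"
        unfolding c0_def using n assms(1) by (intro mult_nonpos_nonneg) auto
      show "c3 \<ge> 0" "c4 \<ge> 0"
        unfolding c3_def c4_def using n assms(1) by auto
      show "c1 \<le> 0 \<or> c2 \<ge> 0"
        unfolding c2_def using n assms(1) by auto
      fix k m assume "k + m = N"
      show "turan_poly \<beta> \<mu> (real k) (real m) =
          c0 + c1 * (real k * real m) + c2 * (real k * real m)^2 + c3 * (real k * real m)^3
            + c4 * (real k * real m)^4"
        unfolding c0_def c1_def c2_def c3_def c4_def N[OF \<open>k + m = N\<close>] turan_poly_def \<open>\<beta> = 2\<close>
          pochhammer_numerals of_nat_numeral of_nat_1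
        by algebra
    qed
  next
    case 3
    define c0 :: real where "c0 =
       - (n * (n - 1)) *
       ((7 * \<mu>^6 + 108 * \<mu>^5 + 625 * \<mu>^4 + 1680 * \<mu>^3 + 2068 * \<mu>^2 + 912 * \<mu>) * n^2
        + (9 * \<mu>^7 + 154 * \<mu>^6 + 1035 * \<mu>^5 + 3490 * \<mu>^4 + 6216 * \<mu>^3 + 5536 * \<mu>^2
        + 1920 * \<mu>) * n + (3 * \<mu>^8 + 57 * \<mu>^7 + 441 * \<mu>^6 + 1803 * \<mu>^5 + 4212 * \<mu>^4
        + 5628 * \<mu>^3 + 3984 * \<mu>^2 + 1152 * \<mu>))"
    define c1 :: real where "c1 =
       (- 18 * \<mu>^5 - 222 * \<mu>^4 - 870 * \<mu>^3 - 1026 * \<mu>^2 + 612 * \<mu> + 1248) * n^3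
        + (17 * \<mu>^6 + 351 * \<mu>^5 + 2807 * \<mu>^4 + 10797 * \<mu>^3 + 20936 * \<mu>^2 + 19596 * \<mu>
        + 7200) * n^2 + (36 * \<mu>^7 + 687 * \<mu>^6 + 5301 * \<mu>^5 + 21243 * \<mu>^4 + 47619 * \<mu>^3
        + 59814 * \<mu>^2 + 38976 * \<mu> + 9984) * n + (12 * \<mu>^8 + 246 * \<mu>^7 + 2096 * \<mu>^6
        + 9678 * \<mu>^5 + 26516 * \<mu>^4 + 44196 * \<mu>^3 + 43592 * \<mu>^2 + 22848 * \<mu> + 4608)"
    \<comment> \<open>For large n and \<open>\<mu>\<close> this is negative, so neither
      \<open>c1\<close> nor \<open>c2\<close> has a fixed sign.\<close>
    define c2 :: real where "c2 =
       (- 12 * \<mu>^4 - 96 * \<mu>^3 + 48 * \<mu>^2 + 1176 * \<mu> + 1560) * n^2 + (72 * \<mu>^5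
        + 1086 * \<mu>^4 + 6144 * \<mu>^3 + 15450 * \<mu>^2 + 16620 * \<mu> + 5928) * n + (44 * \<mu>^6
        + 702 * \<mu>^5 + 4316 * \<mu>^4 + 12762 * \<mu>^3 + 18680 * \<mu>^2 + 12096 * \<mu> + 1824)"
    define c3 :: real where "c3 =
       (24 * \<mu>^2 + 384 * \<mu> + 696) * n + (48 * \<mu>^4 + 600 * \<mu>^3 + 2616 * \<mu>^2
        + 4152 * \<mu> + 1632)"
    define c4 :: real where "c4 = 96"
    show ?thesis
    proof (rule that[of c0 c1 c2 c3 c4])
      show "c0 \<le> 0"
        unfolding c0_def using n assms(1) by (intro mult_nonpos_nonneg) auto
      show "c3 \<ge> 0" "c4 \<ge> 0"
        unfolding c3_def c4_def using n assms(1) by auto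
      \<comment> \<open>The multiplier is chosen so that every coefficient of the difference is positive;
        hence \<open>c1\<close> is negative whenever \<open>c2\<close> is.\<close>
      have "(2 * \<mu> * n + 2 * n + \<mu>^2 + 10) * c2 - 2 * c1 =
        (12 * \<mu>^5 + 228 * \<mu>^4 + 1644 * \<mu>^3 + 4500 * \<mu>^2 + 4248 * \<mu> + 624) * n^3
        + (98 * \<mu>^6 + 1518 * \<mu>^5 + 8774 * \<mu>^4 + 21810 * \<mu>^3 + 24308 * \<mu>^2 + 17664 * \<mu>
        + 13056) * n^2 + (88 * \<mu>^7 + 1204 * \<mu>^6 + 6298 * \<mu>^5 + 17980 * \<mu>^4 + 45706 * \<mu>^3
        + 102352 * \<mu>^2 + 116088 * \<mu> + 42960) * n + (20 * \<mu>^8 + 210 * \<mu>^7 + 564 * \<mu>^6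
        + 426 * \<mu>^5 + 8808 * \<mu>^4 + 51324 * \<mu>^3 + 101440 * \<mu>^2 + 75264 * \<mu> + 9024)"
        unfolding c1_def c2_def by algebra
      also have "\<dots> \<ge> 0" using n assms(1) by (intro add_nonneg_nonneg mult_nonneg_nonneg) auto
      finally have le: "2 * c1 \<le> (2 * \<mu> * n + 2 * n + \<mu>^2 + 10) * c2" by simp
      show "c1 \<le> 0 \<or> c2 \<ge> 0"
      proof (rule disjCI)
        assume "\<not> c2 \<ge> 0"
        then have "(2 * \<mu> * n + 2 * n + \<mu>^2 + 10) * c2 \<le> 0"
          using n assms(1) by (intro mult_nonneg_nonpos) auto
        with le show "c1 \<le> 0" by simp
      qed
      fix k m assume "k + m = N"
      show "turan_poly \<beta> \<mu> (real k) (real m) =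
          c0 + c1 * (real k * real m) + c2 * (real k * real m)^2 + c3 * (real k * real m)^3
            + c4 * (real k * real m)^4"
        unfolding c0_def c1_def c2_def c3_def c4_def N[OF \<open>k + m = N\<close>] turan_poly_def \<open>\<beta> = 3\<close>
          pochhammer_numerals of_nat_numeral of_nat_1
        by algebra
    qed
  qed
qed

text \<open>The coefficients in \<open>turan_poly_expand\<close> depend on the indices only through
  their sum, so one polynomial in q serves both pairs and \<open>quartic_pos_mono\<close>
  applies.\<close>

lemma turan_kernel_pos_mono:
  assumes "\<mu> > 0" "\<beta> \<in> {1, 2, 3}" "k + m = k' + m'" "k * m \<le> k' * m'"
    and "turan_kernel \<beta> \<mu> k m > 0"
  shows "turan_kernel \<beta> \<mu> k' m' > 0"
proof -
  have iff: "turan_kernel \<beta> \<mu> k m > 0 \<longleftrightarrow> turan_poly \<beta> \<mu> k m > 0" for k m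
  proof -
    have "\<mu>^2 * pochhammer (\<mu> + k + 1) (Suc \<beta>) * pochhammer (\<mu> + m + 1) (Suc \<beta>) > 0"
      using assms(1) by (intro mult_pos_pos pochhammer_pos) auto
    moreover have "catalan_coeff \<mu> k * catalan_coeff \<mu> m > 0"
      using assms(1) by (intro mult_pos_pos catalan_coeff_pos)
    ultimately show ?thesis
      using turan_kernel_eq[OF assms(1), of \<beta> k m] by (metis zero_less_mult_pos zero_less_mult_pos2 mult_pos_pos)
  qed
  obtain c0 c1 c2 c3 c4 where c: "c0 \<le> 0" "c1 \<le> 0 \<or> c2 \<ge> 0" "c3 \<ge> 0" "c4 \<ge> 0"
    and eq: "\<And>i j. i + j = k + m \<Longrightarrow> turan_poly \<beta> \<mu> (real i) (real j) =
      c0 + c1 * (real i * real j) + c2 * (real i * real j)^2 + c3 * (real i * real j)^3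
        + c4 * (real i * real j)^4"
    using turan_poly_expand[OF assms(1,2), of "k + m"] by metis
  have "real k * real m \<le> real k' * real m'"
    using assms(4) by (metis of_nat_le_iff of_nat_mult)
  then show ?thesis
    using assms(3,5) quartic_pos_mono[OF c, of "real k * real m" "real k' * real m'"]
    unfolding iff by (simp add: eq)
qed

section \<open>Turanians of the weighted series\<close>

definition weighted_catalan_fps :: "(nat \<Rightarrow> real) \<Rightarrow> real \<Rightarrow> real fps" where
  "weighted_catalan_fps f \<mu> = Abs_fps (\<lambda>n. f n * catalan_coeff \<mu> n)"

lemma turan_nth_nonneg:
  fixes f :: "nat \<Rightarrow> real"
  assumes "\<mu> > 0" "\<beta> \<in> {1, 2, 3}"
    and lc: "\<And>n. f n * f (Suc (Suc n)) \<le> f (Suc n) ^ 2"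
    and f0: "f 0 \<ge> 0" and pos: "\<And>n. f (Suc n) > 0"
  defines "W \<equiv> weighted_catalan_fps f"
  shows "fps_nth (W (\<mu> + 1) * W (\<mu> + real \<beta>) - W \<mu> * W (\<mu> + 1 + real \<beta>)) n \<ge> 0"
proof -
  let ?c = "catalan_coeff"
  define g v w where "g k = f k * f (n - k)"
    and "v k = ?c (\<mu> + 1) k * ?c (\<mu> + real \<beta>) (n - k) - ?c \<mu> k * ?c (\<mu> + 1 + real \<beta>) (n - k)"
    and "w k = turan_kernel \<beta> \<mu> k (n - k)" for k
  have w: "w k = v k + v (n - k)" if "k \<le> n" for k
    using that by (simp add: v_def w_def turan_kernel_def)
  have g: "g (n - k) = g k" if "k \<le> n" for k
    using that by (simp add: g_def)
  have sym: "(\<Sum>k\<le>n. h (n - k)) = (\<Sum>k\<le>n. h k)" for h :: "nat \<Rightarrow> real"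
    using sum.nat_diff_reindex[of h "Suc n"] by (simp add: lessThan_Suc_atMost)
  have "(\<Sum>k\<le>n. v k) = 0"
    using catalan_coeff_convolution[of \<mu> "\<mu> + real \<beta>" n] assms(1)
    by (simp add: v_def sum_subtractf add_ac)
  then have w0: "(\<Sum>k\<le>n. w k) = 0"
    using sym[of v] by (simp add: w sum.distrib)
  have gw: "(\<Sum>k\<le>n. g k * w k) \<ge> 0"
  proof (rule sum_weighted_nonneg)
    fix i j assume ij: "i \<in> {..n}" "j \<in> {..n}" "w i > 0" "w j < 0"
    \<comment> \<open>Otherwise positivity would pass from \<open>w i\<close> to \<open>w j\<close>.
      Hence \<open>i\<close> belongs to the closer pair, and log-concavity compares the
      weights.\<close>
    have "\<not> i * (n - i) \<le> j * (n - j)"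
      using turan_kernel_pos_mono[OF assms(1,2), of i "n - i" j "n - j"] ij by (auto simp: w_def)
    then show "g j \<le> g i"
      unfolding g_def using ij by (intro log_concave_nat_mult_le lc f0 pos) auto
  qed (use w0 in auto)
  \<comment> \<open>As \<open>g\<close> is symmetric under k -> n - k, this sum is twice the n-th
    coefficient of the Turanian.\<close>
  have "(\<Sum>k\<le>n. g k * w k) = (\<Sum>k\<le>n. g k * v k) + (\<Sum>k\<le>n. g k * v (n - k))"
    by (simp add: w distrib_left sum.distrib)
  also have "(\<Sum>k\<le>n. g k * v (n - k)) = (\<Sum>k\<le>n. g (n - k) * v (n - k))"
    by (intro sum.cong) (auto simp: g)
  also have "\<dots> = (\<Sum>k\<le>n. g k * v k)" by (rule sym)
  finally have "(\<Sum>k\<le>n. g k * v k) \<ge> 0" using gw by simp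
  moreover have "fps_nth (W (\<mu> + 1) * W (\<mu> + real \<beta>) - W \<mu> * W (\<mu> + 1 + real \<beta>)) n = (\<Sum>k\<le>n. g k * v k)"
    unfolding W_def weighted_catalan_fps_def fps_sub_nth fps_mult_nth fps_nth_Abs_fps
      sum_subtractf[symmetric] atLeast0AtMost
    by (intro sum.cong refl) (simp add: g_def v_def algebra_simps)
  ultimately show ?thesis by simp
qed

lemma turan_nth_nonneg_le_4:
  fixes f :: "nat \<Rightarrow> real"
  assumes "\<mu> > 0" "\<alpha> \<ge> 1" "\<beta> \<ge> 1" "\<alpha> + \<beta> \<le> 4"
    and lc: "\<And>n. f n * f (Suc (Suc n)) \<le> f (Suc n) ^ 2"
    and f0: "f 0 \<ge> 0" and pos: "\<And>n. f (Suc n) > 0"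
  defines "W \<equiv> weighted_catalan_fps f"
  shows "fps_nth (W (\<mu> + real \<alpha>) * W (\<mu> + real \<beta>) - W \<mu> * W (\<mu> + real \<alpha> + real \<beta>)) n \<ge> 0"
proof -
  note T = turan_nth_nonneg[OF _ _ lc f0 pos, folded W_def, where n = n]
  consider "\<alpha> = 1" "\<beta> \<in> {1, 2, 3}" | "\<beta> = 1" "\<alpha> \<in> {1, 2, 3}" | "\<alpha> = 2" "\<beta> = 2"
    using assms(2-4) by force
  then show ?thesis
  proof cases
    case 1
    then show ?thesis using T[OF assms(1), of \<beta>] by simp
  next
    case 2
    then show ?thesis using T[OF assms(1), of \<alpha>] by (simp add: mult.commute add_ac)
  next
    case 3
    \<comment> \<open>The product of the series at mu + 1 and mu + 3 is subtracted and
      added.\<close>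
    have "W (\<mu> + 2) * W (\<mu> + 2) - W \<mu> * W (\<mu> + 4) =
        (W (\<mu> + 1 + 1) * W (\<mu> + 1 + real 1) - W (\<mu> + 1) * W (\<mu> + 1 + 1 + real 1))
      + (W (\<mu> + 1) * W (\<mu> + real 3) - W \<mu> * W (\<mu> + 1 + real 3))"
      by (simp add: add_ac)
    then show ?thesis using T[of "\<mu> + 1" 1] T[of \<mu> 3] assms(1) 3
      by (simp only: fps_add_nth) (simp add: add_ac)
  qed
qed

lemma eval_turan_nonneg:
  fixes f :: "nat \<Rightarrow> real"
  assumes "\<mu> > 0" "0 < x" "x < 1"
    and lc: "\<And>n. f n * f (Suc (Suc n)) \<le> f (Suc n) ^ 2"
    and f0: "f 0 \<ge> 0" and pos: "\<And>n. f (Suc n) > 0"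
  defines "W \<equiv> weighted_catalan_fps f"
  assumes conv: "\<And>\<mu>. \<mu> > 0 \<Longrightarrow> fps_conv_radius (W \<mu>) \<ge> 1"
  shows "eval_fps (W \<mu>) x * eval_fps (W (\<mu> + real \<alpha> + real \<beta>)) x
    \<le> eval_fps (W (\<mu> + real \<alpha>)) x * eval_fps (W (\<mu> + real \<beta>)) x"
proof -
  define h where "h j = eval_fps (W (\<mu> + real j)) x" for j
  have nth: "fps_nth (W \<nu>) n \<ge> 0" if "\<nu> > 0" for \<nu> n
  proof -
    have "f n \<ge> 0" using f0 pos by (cases n) (auto intro: less_imp_le)
    then show ?thesis
      using catalan_coeff_pos[OF that, of n] by (simp add: W_def weighted_catalan_fps_def)
  qed
  have radius: "ereal (norm x) < fps_conv_radius (W \<nu>)" if "\<nu> > 0" for \<nu>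
    using assms(2,3) by (intro less_le_trans[OF _ conv[OF that]]) simp
  have eval_nonneg: "eval_fps F x \<ge> 0"
    if "ereal (norm x) < fps_conv_radius F" "\<And>n. fps_nth F n \<ge> 0" for F :: "real fps"
    unfolding eval_fps_def using that assms(2) by (intro suminf_nonneg summable_fps) auto
  have hpos: "h j > 0" for j
  proof -
    have j: "\<mu> + real j > 0" using assms(1) by simp
    \<comment> \<open>Strict positivity is taken from the linear coefficient because
      \<open>f 0\<close> may be 0.\<close>
    have "fps_nth (W (\<mu> + real j)) 1 > 0"
      using pos[of 0] catalan_coeff_pos[OF j, of 1] by (simp add: W_def weighted_catalan_fps_def)
    then show ?thesis
      unfolding h_def eval_fps_def using assms(2)
      by (intro suminf_pos2[of _ 1] summable_fps radius j mult_nonneg_nonneg nth mult_pos_pos) auto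
  qed
  have hlc: "h j * h (Suc (Suc j)) \<le> h (Suc j) ^ 2" for j
  proof -
    define \<nu> where "\<nu> = \<mu> + real j"
    have \<nu>: "\<nu> > 0" "\<nu> + 1 > 0" "\<nu> + 2 > 0" using assms(1) by (simp_all add: \<nu>_def)
    let ?D = "W (\<nu> + 1) * W (\<nu> + 1) - W \<nu> * W (\<nu> + 2)"
    have r: "ereal (norm x) < fps_conv_radius (W (\<nu> + 1) * W (\<nu> + 1))"
      "ereal (norm x) < fps_conv_radius (W \<nu> * W (\<nu> + 2))"
      using radius[OF \<nu>(1)] radius[OF \<nu>(2)] radius[OF \<nu>(3)]
      by (auto intro!: less_le_trans[OF _ fps_conv_radius_mult])
    have "0 \<le> eval_fps ?D x"
    proof (rule eval_nonneg)
      show "ereal (norm x) < fps_conv_radius ?D"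
        using r by (intro less_le_trans[OF _ fps_conv_radius_diff]) auto
      show "fps_nth ?D n \<ge> 0" for n
        using turan_nth_nonneg[OF \<nu>(1) _ lc f0 pos, of 1 n] by (simp add: W_def add_ac)
    qed
    also have "\<dots> = eval_fps (W (\<nu> + 1)) x ^ 2 - eval_fps (W \<nu>) x * eval_fps (W (\<nu> + 2)) x"
      using r radius[OF \<nu>(1)] radius[OF \<nu>(2)] radius[OF \<nu>(3)]
      by (simp add: eval_fps_diff eval_fps_mult power2_eq_square)
    finally show ?thesis by (simp add: h_def \<nu>_def add_ac)
  qed
  \<comment> \<open>The pairs (0, alpha + beta) and (alpha, beta) have equal sums, and the first has
    product 0.\<close>
  have "h 0 * h (\<alpha> + \<beta>) \<le> h \<alpha> * h \<beta>"
    by (rule log_concave_nat_mult_le) (auto intro: hlc hpos less_imp_le)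
  then show ?thesis by (simp add: h_def add_ac)
qed

section \<open>The weights belonging to F_1 and F_2\<close>

text \<open>The sum is the logarithmic derivative of \<open>pochhammer c n\<close>:
  \<open>c = a\<close> gives the derivative in a, and \<open>c = b\<close> the negated derivative in
  b.\<close>

definition harmonic_weight :: "real \<Rightarrow> real \<Rightarrow> real \<Rightarrow> nat \<Rightarrow> real" where
  "harmonic_weight a b c n = pochhammer a n / pochhammer b n * (\<Sum>k<n. 1 / (c + real k))"

lemma harmonic_weight_0: "harmonic_weight a b c 0 \<ge> 0"
  by (simp add: harmonic_weight_def)

lemma harmonic_weight_pos:
  assumes "a > 0" "b > 0" "c > 0"
  shows "harmonic_weight a b c (Suc n) > 0"
  unfolding harmonic_weight_def using assms
  by (intro mult_pos_pos divide_pos_pos pochhammer_pos sum_pos) (auto intro: add_pos_nonneg)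

text \<open>A product of two nonnegative log-concave sequences: the quotient of rising factorials
  has decreasing ratios (a + n) / (b + n), and the harmonic sum has decreasing increments.\<close>

lemma harmonic_weight_log_concave:
  assumes "a \<ge> b" "b > 0" "c > 0"
  shows "harmonic_weight a b c n * harmonic_weight a b c (Suc (Suc n)) \<le> harmonic_weight a b c (Suc n) ^ 2"
proof -
  define r where "r = pochhammer a n / pochhammer b n"
  define s t where "s = (a + n) / (b + n)" and "t = (a + n + 1) / (b + n + 1)"
  define H x y where "H = (\<Sum>k<n. 1 / (c + real k))" and "x = 1 / (c + n)" and "y = 1 / (c + n + 1)"
  \<comment> \<open>Here \<open>a \<ge> b\<close> enters: (a + n) / (b + n) = 1 + (a - b) / (b +
    n).\<close>
  have ts: "0 \<le> t" "t \<le> s" using assms by (auto simp: s_def t_def field_simps)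
  have xy: "0 \<le> y" "y \<le> x" using assms by (auto simp: x_def y_def field_simps)
  have H: "H \<ge> 0" using assms by (auto simp: H_def intro!: sum_nonneg)
  \<comment> \<open>The difference of the two sides of \<open>harm\<close> is H (x - y) +
    x^2.\<close>
  have "H * y \<le> H * x" by (intro mult_left_mono xy H)
  also have "\<dots> \<le> H * x + x^2" using xy H by simp
  finally have harm: "H * (H + x + y) \<le> (H + x)^2" by (simp add: power2_eq_square algebra_simps)
  have "harmonic_weight a b c n * harmonic_weight a b c (Suc (Suc n)) =
      (r^2 * s) * (t * (H * (H + x + y)))"
    by (simp add: harmonic_weight_def pochhammer_Suc r_def s_def t_def H_def x_def y_def
        power2_eq_square mult_ac add_ac)
  also have "\<dots> \<le> (r^2 * s) * (s * (H + x)^2)"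
    using ts xy H harm by (intro mult_left_mono mult_mono) auto
  also have "\<dots> = harmonic_weight a b c (Suc n) ^ 2"
    by (simp add: harmonic_weight_def pochhammer_Suc r_def s_def H_def x_def
        power2_eq_square mult_ac)
  finally show ?thesis .
qed

lemma F1_fps_eq:
  assumes "a > 0" "b > 0" "\<mu> > 0"
  shows "F1_fps a b \<mu> = weighted_catalan_fps (harmonic_weight a b a) \<mu>"
  using assms by (intro fps_ext)
    (simp add: F1_fps_nth weighted_catalan_fps_def harmonic_weight_def hyp_3F2_nth catalan_coeff_def mult_ac)

lemma F2_fps_eq:
  assumes "a > 0" "b > 0" "\<mu> > 0"
  shows "F2_fps a b \<mu> = weighted_catalan_fps (harmonic_weight a b b) \<mu>"
  using assms by (intro fps_ext)
    (simp add: F2_fps_nth weighted_catalan_fps_def harmonic_weight_def hyp_3F2_nth catalan_coeff_def mult_ac)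

theorem theorem6p6:
  fixes a b \<mu> :: real and \<alpha> \<beta> :: nat
  assumes "a \<ge> b" and "b > 0" and "\<mu> > 0" and "\<alpha> \<ge> 1" and "\<beta> \<ge> 1"
  shows "(\<forall>x. 0 < x \<and> x < 1 \<longrightarrow>
           F1 a b (\<mu> + real \<alpha>) x * F1 a b (\<mu> + real \<beta>) x
             - F1 a b \<mu> x * F1 a b (\<mu> + real \<alpha> + real \<beta>) x \<ge> 0)
       \<and> (\<forall>x. 0 < x \<and> x < 1 \<longrightarrow>
           F2 a b (\<mu> + real \<alpha>) x * F2 a b (\<mu> + real \<beta>) x
             - F2 a b \<mu> x * F2 a b (\<mu> + real \<alpha> + real \<beta>) x \<ge> 0)
       \<and> (\<alpha> + \<beta> \<le> 4 \<longrightarrow> (\<forall>n. fps_nth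
           (F1_fps a b (\<mu> + real \<alpha>) * F1_fps a b (\<mu> + real \<beta>)
             - F1_fps a b \<mu> * F1_fps a b (\<mu> + real \<alpha> + real \<beta>)) n \<ge> 0))
       \<and> (\<alpha> + \<beta> \<le> 4 \<longrightarrow> (\<forall>n. fps_nth
           (F2_fps a b (\<mu> + real \<alpha>) * F2_fps a b (\<mu> + real \<beta>)
             - F2_fps a b \<mu> * F2_fps a b (\<mu> + real \<alpha> + real \<beta>)) n \<ge> 0))"
proof -
  have a: "a > 0" using assms(1,2) by simp
  note W = harmonic_weight_log_concave[OF assms(1,2)] harmonic_weight_0
    harmonic_weight_pos[OF a assms(2)]
  note eq1 = F1_fps_eq[OF a assms(2)] and eq2 = F2_fps_eq[OF a assms(2)]
  have shift: "\<mu> + real j > 0" "\<mu> + real i + real j > 0" for i j using assms(3) by auto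
  have conv1: "fps_conv_radius (weighted_catalan_fps (harmonic_weight a b a) \<nu>) \<ge> 1" if "\<nu> > 0" for \<nu>
    using conv_radius_F1[OF a assms(2) that] by (simp add: eq1[OF that])
  have conv2: "fps_conv_radius (weighted_catalan_fps (harmonic_weight a b b) \<nu>) \<ge> 1" if "\<nu> > 0" for \<nu>
    using conv_radius_F2[OF a assms(2) that] by (simp add: eq2[OF that])
  show ?thesis
    unfolding F1_def F2_def eq1[OF assms(3)] eq2[OF assms(3)] eq1[OF shift(1)] eq1[OF shift(2)]
      eq2[OF shift(1)] eq2[OF shift(2)] diff_ge_0_iff_ge
    by (intro conjI impI allI eval_turan_nonneg turan_nth_nonneg_le_4 W a assms conv1 conv2; simp)
qed

end
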